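(* Fix an integer $d\ge 1$. There is a constant $C_d>0$ (depending only on $d$) such that the following holds. For all side lengths $n_1,\dots,n_d$, every $\Lambda\ge0$, every integer initial load vector $x^{(0)}=\xi^{(0)}$ on the (not necessarily uniform) $d$-dimensional torus $T(n_1,\dots,n_d)$ with $n=n_1\cdots n_d$ vertices, and every discrete process with accumulated rounding errors at most $\Lambda$, one has $|x^{(t)}_\ell-\xi^{(t)}_\ell|\le C_d\Lambda$ for every vertex $\ell$ and every time $t\ge0$ (i.e. the deviation is $O(\Lambda)$ at all times).
   Context: The $d$-dimensional torus $T(n_1,\dots,n_d)$ has vertex set $\{0,\dots,n_1-1\}\times\cdots\times\{0,\dots,n_d-1\}$, and each vertex $(i_1,\dots,i_d)$ is adjacent to the $2d$ vertices obtained by changing one coordinate $i_k$ to $(i_k\pm1)\bmod n_k$. The dimension $d$ is treated as a constant. Diffusion matrix: for a connected graph $G=(V,E)$ with maximum degree $\Delta$, $P_{i,j}=1/(2\Delta)$ if $\{i,j\}\in E$, $P_{i,i}=1-\deg(i)/(2\Delta)$, $P_{i,j}=0$ otherwise. Idealized process: $\xi^{(t)}=\xi^{(t-1)}P$ (row vectors). Discrete process: integer loads $x^{(t)}$; at each step $t\ge1$, for each edge $\{i,j\}$ an integer flow $\Phi^{(t)}_{i,j}=-\Phi^{(t)}_{j,i}$ is sent from $i$ to $j$, $x^{(t)}_i=x^{(t-1)}_i-\sum_{j:\{i,j\}\in E}\Phi^{(t)}_{i,j}$; rounding error $e^{(t)}_{i,j}=(P_{i,j}x^{(t-1)}_i-P_{j,i}x^{(t-1)}_j)-\Phi^{(t)}_{i,j}$.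 The process has accumulated rounding errors at most $\Lambda$ if $|\sum_{s=1}^t e^{(s)}_{i,j}|\le\Lambda$ for all $t\ge1$ and all edges. Both processes start from $x^{(0)}=\xi^{(0)}$; the deviation at $\ell$ and time $t$ is $|x^{(t)}_\ell-\xi^{(t)}_\ell|$. *)

theory Defs
  imports Complex_Main "HOL-Library.FuncSet"
begin

section \<open>Diffusion on a finite simple graph\<close>

text \<open>A graph is given by a finite vertex set \<open>V\<close> and a set \<open>E\<close> of two-element subsets of \<open>V\<close>.\<close>

definition neighbours :: "'a set set \<Rightarrow> 'a \<Rightarrow> 'a set" where
  "neighbours E i = {j. {i, j} \<in> E}"

definition degree :: "'a set set \<Rightarrow> 'a \<Rightarrow> nat" where
  "degree E i = card (neighbours E i)"

definition max_degree :: "'a set \<Rightarrow> 'a set set \<Rightarrow> nat" where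
  "max_degree V E = Max (degree E ` V)"

text \<open>For the one-vertex graph the maximum degree is 0; with \<open>x / 0 = 0\<close> the matrix is then
  the identity, as it should be.\<close>

definition diffusion_matrix :: "'a set \<Rightarrow> 'a set set \<Rightarrow> 'a \<Rightarrow> 'a \<Rightarrow> real" where
  "diffusion_matrix V E i j =
     (if i = j then 1 - real (degree E i) / (2 * real (max_degree V E))
      else if {i, j} \<in> E then 1 / (2 * real (max_degree V E))
      else 0)"

primrec idealized_load ::
  "'a set \<Rightarrow> 'a set set \<Rightarrow> ('a \<Rightarrow> real) \<Rightarrow> nat \<Rightarrow> 'a \<Rightarrow> real" where
  "idealized_load V E \<xi>0 0 = \<xi>0"
| "idealized_load V E \<xi>0 (Suc t) =
     (\<lambda>j. \<Sum>i\<in>V. idealized_load V E \<xi>0 t i * diffusion_matrix V E i j)"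

text \<open>\<open>x t i\<close> is the load of vertex \<open>i\<close> after step \<open>t\<close>, and \<open>\<Phi> t i j\<close> is the flow from \<open>i\<close> to \<open>j\<close>
  in step \<open>t \<ge> 1\<close>; the value of \<open>\<Phi>\<close> at time 0 and on non-edges is irrelevant.\<close>

definition discrete_process ::
  "'a set \<Rightarrow> 'a set set \<Rightarrow> (nat \<Rightarrow> 'a \<Rightarrow> int) \<Rightarrow> (nat \<Rightarrow> 'a \<Rightarrow> 'a \<Rightarrow> int) \<Rightarrow> bool" where
  "discrete_process V E x \<Phi> \<longleftrightarrow>
     (\<forall>t\<ge>1.
        (\<forall>i j. {i, j} \<in> E \<longrightarrow> \<Phi> t i j = - \<Phi> t j i) \<and>
        (\<forall>i\<in>V. x t i = x (t - 1) i - (\<Sum>j\<in>neighbours E i. \<Phi> t i j)))"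

definition rounding_error ::
  "'a set \<Rightarrow> 'a set set \<Rightarrow> (nat \<Rightarrow> 'a \<Rightarrow> int) \<Rightarrow> (nat \<Rightarrow> 'a \<Rightarrow> 'a \<Rightarrow> int) \<Rightarrow>
     nat \<Rightarrow> 'a \<Rightarrow> 'a \<Rightarrow> real" where
  "rounding_error V E x \<Phi> t i j =
     (diffusion_matrix V E i j * real_of_int (x (t - 1) i)
        - diffusion_matrix V E j i * real_of_int (x (t - 1) j))
     - real_of_int (\<Phi> t i j)"

definition accumulated_errors_at_most ::
  "'a set \<Rightarrow> 'a set set \<Rightarrow> (nat \<Rightarrow> 'a \<Rightarrow> int) \<Rightarrow> (nat \<Rightarrow> 'a \<Rightarrow> 'a \<Rightarrow> int) \<Rightarrow> real \<Rightarrow> bool" where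
  "accumulated_errors_at_most V E x \<Phi> \<Lambda> \<longleftrightarrow>
     (\<forall>t\<ge>1. \<forall>i j. {i, j} \<in> E \<longrightarrow> \<bar>\<Sum>s=1..t. rounding_error V E x \<Phi> s i j\<bar> \<le> \<Lambda>)"

definition deviation ::
  "'a set \<Rightarrow> 'a set set \<Rightarrow> (nat \<Rightarrow> 'a \<Rightarrow> int) \<Rightarrow> nat \<Rightarrow> 'a \<Rightarrow> real" where
  "deviation V E x t l =
     \<bar>real_of_int (x t l) - idealized_load V E (\<lambda>i. real_of_int (x 0 i)) t l\<bar>"

section \<open>The torus\<close>

text \<open>Vertices are functions on the index set \<open>{1..d}\<close> (\<open>undefined\<close> elsewhere).\<close>

definition torus_vertices :: "nat \<Rightarrow> (nat \<Rightarrow> nat) \<Rightarrow> (nat \<Rightarrow> int) set" where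
  "torus_vertices d n = (\<Pi>\<^sub>E k\<in>{1..d}. {0..<int (n k)})"

text \<open>The torus is a simple graph: for \<open>n k = 1\<close> the loop in direction \<open>k\<close> is dropped, and for
  \<open>n k = 2\<close> the two neighbours in direction \<open>k\<close> coincide.  If all \<open>n k \<ge> 3\<close>, it is
  \<open>2 * d\<close>-regular.\<close>

definition torus_edges :: "nat \<Rightarrow> (nat \<Rightarrow> nat) \<Rightarrow> (nat \<Rightarrow> int) set set" where
  "torus_edges d n =
     {{v, w} | v w. v \<in> torus_vertices d n \<and> w \<noteq> v \<and>
        (\<exists>k\<in>{1..d}. w = v(k := (v k + 1) mod int (n k)) \<or>
                     w = v(k := (v k - 1) mod int (n k)))}"

end

theory Submission
  imports Defs "HOL-Library.Function_Algebras"
begin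

text \<open>Write the deviation at \<open>l\<close> as a sum over time and edges of the rounding errors times the
  differences of \<open>P\<^sup>u \<delta>\<^sub>l\<close> along the edges. Summation by parts in time replaces the rounding errors
  by the accumulated ones, so it suffices to bound, independently of the side lengths, the sum over
  \<open>u\<close> of the \<open>\<ell>\<^sup>1\<close> norms of \<open>(1 - S) (1 - P) P\<^sup>u \<delta>\<^sub>l\<close>, where \<open>S\<close> is the shift by a generator.
  The torus is a Cayley graph of an abelian group, and \<open>1 - P\<close> is an average of second differences
  \<open>(1 - T) (1 - T\<^sup>-\<^sup>1)\<close> over the generators. Distributing \<open>P\<^sup>u\<close> over the three resulting first
  differences, each is of size \<open>O(u\<^sup>-\<^sup>1\<^sup>/\<^sup>2)\<close>: \<open>P\<close> contains a positive multiple of the lazy shift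
  \<open>(1 + S) / 2\<close>, all operators commute, and \<open>(1 - S) (1 + S)\<^sup>m / 2\<^sup>m\<close> has norm \<open>O(m\<^sup>-\<^sup>1\<^sup>/\<^sup>2)\<close> by the
  variance of the binomial distribution. The resulting \<open>O(u\<^sup>-\<^sup>3\<^sup>/\<^sup>2)\<close> is summable.\<close>

section \<open>Binomial sums\<close>

text \<open>Pascal's rule, stated with vector values so that it serves both the real binomial sums
  and the expansion of powers of operators.\<close>

lemma sum_choose_Suc:
  fixes \<phi> :: "nat \<Rightarrow> 'v::real_vector"
  shows "(\<Sum>j\<le>Suc m. real (Suc m choose j) *\<^sub>R \<phi> j) =
    (\<Sum>j\<le>m. real (m choose j) *\<^sub>R (\<phi> j + \<phi> (Suc j)))"
proof -
  have "(\<Sum>j\<le>Suc m. real (Suc m choose j) *\<^sub>R \<phi> j) =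
      \<phi> 0 + (\<Sum>j\<le>m. real (Suc m choose Suc j) *\<^sub>R \<phi> (Suc j))"
    by (subst sum.atMost_Suc_shift) simp
  also have "\<dots> = (\<phi> 0 + (\<Sum>j\<le>m. real (m choose Suc j) *\<^sub>R \<phi> (Suc j)))
      + (\<Sum>j\<le>m. real (m choose j) *\<^sub>R \<phi> (Suc j))"
    by (simp add: scaleR_add_left sum.distrib algebra_simps)
  also have "\<phi> 0 + (\<Sum>j\<le>m. real (m choose Suc j) *\<^sub>R \<phi> (Suc j)) =
      (\<Sum>j\<le>Suc m. real (m choose j) *\<^sub>R \<phi> j)"
    by (subst sum.atMost_Suc_shift) simp
  also have "\<dots> = (\<Sum>j\<le>m. real (m choose j) *\<^sub>R \<phi> j)"
    by simp
  finally show ?thesis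
    by (simp add: scaleR_add_right sum.distrib)
qed

text \<open>By Pascal's rule the sum for \<open>Suc m\<close> centred at \<open>a\<close> splits
  into the sums for \<open>m\<close> centred at \<open>a\<close> and \<open>a - 2\<close>, so the
  induction needs an arbitrary centre. At \<open>a = m\<close> this is the variance of a sum of
  \<open>m\<close> random signs.\<close>

lemma binomial_variance:
  "(\<Sum>j\<le>m. real (m choose j) * (a - 2 * real j)\<^sup>2) = 2 ^ m * ((a - real m)\<^sup>2 + real m)"
proof (induction m arbitrary: a)
  case 0
  then show ?case by simp
next
  case (Suc m)
  have "(\<Sum>j\<le>Suc m. real (Suc m choose j) * (a - 2 * real j)\<^sup>2) =
      (\<Sum>j\<le>m. real (m choose j) * ((a - 2 * real j)\<^sup>2 + (a - 2 * real (Suc j))\<^sup>2))"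
    using sum_choose_Suc[of m "\<lambda>j. (a - 2 * real j)\<^sup>2"] by simp
  also have "\<dots> = (\<Sum>j\<le>m. real (m choose j) * (a - 2 * real j)\<^sup>2)
      + (\<Sum>j\<le>m. real (m choose j) * ((a - 2) - 2 * real j)\<^sup>2)"
    by (simp add: sum.distrib distrib_left algebra_simps)
  also have "\<dots> = 2 ^ Suc m * ((a - real (Suc m))\<^sup>2 + real (Suc m))"
    by (simp only: Suc.IH) (simp add: power2_eq_square algebra_simps)
  finally show ?case .
qed

text \<open>The arithmetic-geometric mean inequality stands in for Cauchy-Schwarz: the weight
  \<open>sqrt m\<close> balances the second moment against the total mass.\<close>

lemma binomial_mean_abs_deviation:
  assumes "m > 0"
  shows "(\<Sum>j\<le>m. real (m choose j) * \<bar>real m - 2 * real j\<bar>) \<le> 2 ^ m * sqrt (real m)"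
proof -
  have s: "sqrt (real m) > 0" using assms by simp
  have le: "\<bar>y\<bar> \<le> (y\<^sup>2 / sqrt (real m) + sqrt (real m)) / 2" for y :: real
  proof -
    have "0 \<le> (\<bar>y\<bar> - sqrt (real m))\<^sup>2" by simp
    then have "2 * \<bar>y\<bar> * sqrt (real m) \<le> y\<^sup>2 + sqrt (real m) * sqrt (real m)"
      by (simp add: power2_eq_square algebra_simps)
    with s show ?thesis by (simp add: field_simps)
  qed
  have "(\<Sum>j\<le>m. real (m choose j) * \<bar>real m - 2 * real j\<bar>) \<le>
      (\<Sum>j\<le>m. real (m choose j) * (((real m - 2 * real j)\<^sup>2 / sqrt (real m) + sqrt (real m)) / 2))"
    by (intro sum_mono mult_left_mono le) simp
  also have "\<dots> = ((\<Sum>j\<le>m. real (m choose j) * (real m - 2 * real j)\<^sup>2) / sqrt (real m)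
      + (\<Sum>j\<le>m. real (m choose j)) * sqrt (real m)) / 2"
    unfolding sum_distrib_right sum_divide_distrib sum.distrib[symmetric]
    by (rule sum.cong) (simp_all add: field_simps)
  also have "(\<Sum>j\<le>m. real (m choose j) * (real m - 2 * real j)\<^sup>2) = 2 ^ m * real m"
    by (simp add: binomial_variance)
  also have "(\<Sum>j\<le>m. real (m choose j)) = 2 ^ m"
    by (metis choose_row_sum of_nat_numeral of_nat_power of_nat_sum)
  also have "(2 ^ m * real m / sqrt (real m) + 2 ^ m * sqrt (real m)) / 2 = 2 ^ m * sqrt (real m)"
    using real_div_sqrt[of "real m"] by (simp add: times_divide_eq_right[symmetric] del: times_divide_eq_right)
  finally show ?thesis .
qed

text \<open>Absorption and Pascal's rule express a difference of neighbouring coefficients through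
  the next row, weighted by the distance from its centre. The absolute sum of such differences
  thereby becomes a mean absolute deviation.\<close>

lemma choose_Suc_minus_choose:
  "real (m choose Suc i) - real (m choose i) =
    real (Suc m choose Suc i) * (real (Suc m) - 2 * real (Suc i)) / real (Suc m)"
proof -
  have 1: "real (Suc m) * real (m choose i) = real (Suc m choose Suc i) * real (Suc i)"
    by (metis Suc_times_binomial_eq of_nat_mult)
  have 2: "real (Suc m choose Suc i) = real (m choose i) + real (m choose Suc i)"
    by simp
  have "real (Suc m) * (real (m choose Suc i) - real (m choose i)) =
      real (Suc m) * real (Suc m choose Suc i) - 2 * (real (Suc m) * real (m choose i))"
    unfolding 2 by (simp add: algebra_simps)
  also have "\<dots> = real (Suc m choose Suc i) * (real (Suc m) - 2 * real (Suc i))"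
    unfolding 1 by (simp add: algebra_simps)
  finally show ?thesis
    by (simp add: field_simps del: binomial_Suc_Suc)
qed

text \<open>Absorption turns the weight \<open>1 / Suc m\<close> into a coefficient of row
  \<open>Suc v\<close>, at the cost of a factor \<open>p * Suc v\<close>. What remains is a full
  binomial expansion of 1 without its term at 0.\<close>

lemma binomial_mean_inverse:
  assumes "0 < p" "0 \<le> q" "p + q = (1::real)"
  shows "(\<Sum>m\<le>v. real (v choose m) * p ^ m * q ^ (v - m) / real (Suc m)) \<le> 1 / (p * real (Suc v))"
proof -
  have eq: "real (v choose m) / real (Suc m) = real (Suc v choose Suc m) / real (Suc v)" for m
    using arg_cong[OF Suc_times_binomial_eq[of v m], of real]
    by (simp add: field_simps del: binomial_Suc_Suc)
  have "p * real (Suc v) * (\<Sum>m\<le>v. real (v choose m) * p ^ m * q ^ (v - m) / real (Suc m)) =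
      (\<Sum>m\<le>v. p * real (Suc v) * (real (v choose m) / real (Suc m)) * p ^ m * q ^ (v - m))"
    by (simp add: sum_distrib_left mult_ac)
  also have "\<dots> = (\<Sum>m\<le>v. real (Suc v choose Suc m) * p ^ Suc m * q ^ (Suc v - Suc m))"
    unfolding eq by (simp add: mult_ac del: binomial_Suc_Suc)
  also have "\<dots> \<le> (\<Sum>m\<le>Suc v. real (Suc v choose m) * p ^ m * q ^ (Suc v - m))"
    unfolding sum.atMost_Suc_shift[of _ v] using assms by (simp del: binomial_Suc_Suc)
  also have "\<dots> = 1"
    using binomial_ring[of p q "Suc v"] assms by simp
  finally show ?thesis
    using assms by (subst pos_le_divide_eq) (simp_all add: mult.commute del: of_nat_Suc)
qed

text \<open>Jensen's inequality in elementary form: \<open>y \<le> (r * y * y + 1 / r) / 2\<close>,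
  where \<open>r\<close> is chosen so that after averaging both summands are at most
  \<open>1 / r\<close>.\<close>

lemma binomial_mean_inverse_sqrt:
  assumes "0 < p" "0 \<le> q" "p + q = (1::real)"
  shows "(\<Sum>m\<le>v. real (v choose m) * p ^ m * q ^ (v - m) / sqrt (real (Suc m)))
    \<le> 1 / sqrt (p * real (Suc v))"
proof -
  define r where "r = sqrt (p * real (Suc v))"
  have r: "r > 0" "r * r = p * real (Suc v)"
    using assms by (simp_all add: r_def)
  have le: "1 / sqrt (real (Suc m)) \<le> (r * (1 / real (Suc m)) + 1 / r) / 2" for m
  proof -
    define y where "y = 1 / sqrt (real (Suc m))"
    have yy: "y * y = 1 / real (Suc m)" by (simp add: y_def)
    have "0 \<le> (r * y - 1)\<^sup>2" by simp
    then have "2 * r * y \<le> r * r * (y * y) + 1"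
      by (simp add: power2_eq_square algebra_simps)
    then have "y \<le> (r * (y * y) + 1 / r) / 2"
      using r(1) by (simp add: field_simps)
    then show ?thesis by (simp only: yy y_def[symmetric])
  qed
  have "(\<Sum>m\<le>v. real (v choose m) * p ^ m * q ^ (v - m) / sqrt (real (Suc m))) =
      (\<Sum>m\<le>v. (real (v choose m) * p ^ m * q ^ (v - m)) * (1 / sqrt (real (Suc m))))"
    by simp
  also have "\<dots> \<le> (\<Sum>m\<le>v. (real (v choose m) * p ^ m * q ^ (v - m)) *
      ((r * (1 / real (Suc m)) + 1 / r) / 2))"
    by (intro sum_mono mult_left_mono le) (use assms in simp)
  also have "\<dots> = (r * (\<Sum>m\<le>v. real (v choose m) * p ^ m * q ^ (v - m) / real (Suc m))
      + (\<Sum>m\<le>v. real (v choose m) * p ^ m * q ^ (v - m)) * (1 / r)) / 2"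
    unfolding sum_distrib_left sum_distrib_right sum_divide_distrib sum.distrib[symmetric]
    by (rule sum.cong) (simp_all add: algebra_simps add_divide_distrib)
  also have "(\<Sum>m\<le>v. real (v choose m) * p ^ m * q ^ (v - m)) = 1"
    using binomial_ring[of p q v] assms by simp
  also have "(r * (\<Sum>m\<le>v. real (v choose m) * p ^ m * q ^ (v - m) / real (Suc m)) + 1 * (1 / r)) / 2
      \<le> (r * (1 / (p * real (Suc v))) + 1 * (1 / r)) / 2"
    by (intro divide_right_mono add_right_mono mult_left_mono binomial_mean_inverse assms)
      (use r(1) in simp_all)
  also have "\<dots> = 1 / r"
    unfolding r(2)[symmetric] using r(1) by simp
  finally show ?thesis by (simp add: r_def)
qed

lemma sum_inverse_three_halves_le:
  "(\<Sum>u<t. 1 / (real (Suc u) * sqrt (real (Suc u)))) \<le> 3"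
proof -
  \<comment> \<open>The claim is strengthened so that the right-hand side telescopes: each term is
    at most the drop of \<open>2 / sqrt\<close> between consecutive arguments.\<close>
  have "(\<Sum>u<Suc t. 1 / (real (Suc u) * sqrt (real (Suc u)))) \<le> 3 - 2 / sqrt (real (Suc t))" for t
  proof (induction t)
    case 0
    then show ?case by simp
  next
    case (Suc t)
    define a b where "a = sqrt (real (Suc t))" and "b = sqrt (real (Suc (Suc t)))"
    have ab: "a > 0" "b > 0" "a \<le> b" "b * b - a * a = 1" "b * b = real (Suc (Suc t))"
      by (simp_all add: a_def b_def)
    have "(b - a) * (b + a) = 1" using ab(4) by (simp add: algebra_simps)
    moreover have "(b - a) * (b + a) \<le> (b - a) * (2 * b)"
      using ab by (intro mult_left_mono) auto
    ultimately have "a * 1 \<le> a * ((b - a) * (2 * b))"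
      using ab(1) by (intro mult_left_mono) auto
    also have "\<dots> \<le> b * ((b - a) * (2 * b))"
      using ab by (intro mult_right_mono) auto
    finally have "1 / (b * b * b) \<le> 2 / a - 2 / b"
      using ab(1,2) by (simp add: field_simps)
    then have "1 / (real (Suc (Suc t)) * b) \<le> 2 / a - 2 / b"
      by (simp only: ab(5))
    with Suc show ?case
      unfolding a_def b_def sum.lessThan_Suc[of _ "Suc t"] by linarith
  qed
  from this[of "t - 1"] show ?thesis
  proof (cases t)
    case (Suc s)
    have "0 \<le> 2 / sqrt (real (Suc s))" by simp
    with \<open>_ \<le> 3 - 2 / sqrt (real (Suc (t - 1)))\<close> Suc show ?thesis
      by (simp only: diff_Suc_1)
  qed simp
qed

section \<open>Summation by parts\<close>

text \<open>Peeling off the last error leaves a convolution with the shifted sequence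
  \<open>a (Suc u)\<close>, so the induction must allow every \<open>a\<close>.\<close>

lemma sum_by_parts_convolution:
  fixes e a :: "nat \<Rightarrow> real"
  shows "(\<Sum>s=1..t. e s * a (t - s)) =
    (\<Sum>s=1..t. e s) * a 0 + (\<Sum>u<t. (\<Sum>s=1..t - Suc u. e s) * (a (Suc u) - a u))"
proof (induction t arbitrary: a)
  case 0
  then show ?case by simp
next
  case (Suc t)
  have "(\<Sum>s=1..t. e s * a (Suc t - s)) = (\<Sum>s=1..t. e s * a (Suc (t - s)))"
    by (rule sum.cong) (simp_all add: Suc_diff_le)
  then have "(\<Sum>s=1..Suc t. e s * a (Suc t - s)) =
      (\<Sum>s=1..t. e s * a (Suc (t - s))) + e (Suc t) * a 0"
    by simp
  also have "(\<Sum>s=1..t. e s * a (Suc (t - s))) = (\<Sum>s=1..t. e s) * a (Suc 0) +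
      (\<Sum>u<t. (\<Sum>s=1..t - Suc u. e s) * (a (Suc (Suc u)) - a (Suc u)))"
    by (rule Suc.IH)
  finally show ?case
    by (subst sum.lessThan_Suc_shift) (simp add: algebra_simps)
qed

text \<open>After summation by parts only accumulated errors occur, so the convolution is controlled
  by the initial value and the total variation of \<open>a\<close>.\<close>

lemma abs_convolution_le:
  fixes e a :: "nat \<Rightarrow> real"
  assumes "\<And>t. 1 \<le> t \<Longrightarrow> \<bar>\<Sum>s=1..t. e s\<bar> \<le> \<Lambda>" and "0 \<le> \<Lambda>"
  shows "\<bar>\<Sum>s=1..t. e s * a (t - s)\<bar> \<le> \<Lambda> * (\<bar>a 0\<bar> + (\<Sum>u<t. \<bar>a u - a (Suc u)\<bar>))"
proof -
  \<comment> \<open>The index \<open>t - Suc u\<close> can be 0; the empty sum is covered by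
    \<open>0 \<le> \<Lambda>\<close>.\<close>
  have S: "\<bar>\<Sum>s=1..t. e s\<bar> \<le> \<Lambda>" for t
    using assms(1)[of t] assms(2) by (cases "t = 0") simp_all
  have "\<bar>\<Sum>s=1..t. e s * a (t - s)\<bar> \<le> \<bar>\<Sum>s=1..t. e s\<bar> * \<bar>a 0\<bar> +
      (\<Sum>u<t. \<bar>\<Sum>s=1..t - Suc u. e s\<bar> * \<bar>a (Suc u) - a u\<bar>)"
    unfolding sum_by_parts_convolution abs_mult[symmetric]
    by (rule order.trans[OF abs_triangle_ineq], rule add_left_mono, rule sum_abs)
  also have "\<dots> \<le> \<Lambda> * \<bar>a 0\<bar> + (\<Sum>u<t. \<Lambda> * \<bar>a u - a (Suc u)\<bar>)"
    unfolding abs_minus_commute[of "a (Suc _)"]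
    by (intro add_mono sum_mono mult_right_mono S) simp_all
  finally show ?thesis by (simp add: distrib_left sum_distrib_left)
qed

section \<open>Lazy contractions\<close>

lemma funpow_commute:
  assumes "\<And>x. A (B x) = B (A x)"
  shows "A ((B ^^ n) x) = (B ^^ n) (A x)"
  by (induction n) (simp_all add: assms)

text \<open>The binomial theorem for two commuting operators, with composition powers
  \<open>^^\<close> as the powers; \<open>sum_choose_Suc\<close> supplies the induction
  step.\<close>

lemma binomial_linear:
  fixes A B :: "'v::real_vector \<Rightarrow> 'v"
  assumes A: "linear A" and B: "linear B" and AB: "\<And>x. A (B x) = B (A x)"
  shows "((\<lambda>x. A x + B x) ^^ n) x =
    (\<Sum>m\<le>n. real (n choose m) *\<^sub>R (A ^^ m) ((B ^^ (n - m)) x))"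
proof (induction n)
  case 0
  then show ?case by simp
next
  case (Suc n)
  have "((\<lambda>x. A x + B x) ^^ Suc n) x =
      A (\<Sum>m\<le>n. real (n choose m) *\<^sub>R (A ^^ m) ((B ^^ (n - m)) x)) +
      B (\<Sum>m\<le>n. real (n choose m) *\<^sub>R (A ^^ m) ((B ^^ (n - m)) x))"
    by (simp add: Suc)
  also have "\<dots> = (\<Sum>m\<le>n. real (n choose m) *\<^sub>R
      (B ((A ^^ m) ((B ^^ (n - m)) x)) + A ((A ^^ m) ((B ^^ (n - m)) x))))"
    by (simp add: linear_sum[OF A] linear_sum[OF B] linear_scale[OF A] linear_scale[OF B]
        scaleR_add_right sum.distrib)
  also have "\<dots> = (\<Sum>m\<le>n. real (n choose m) *\<^sub>R
      ((A ^^ m) ((B ^^ (Suc n - m)) x) + (A ^^ Suc m) ((B ^^ (Suc n - Suc m)) x)))"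
    by (intro sum.cong refl) (simp add: Suc_diff_le funpow_commute[of B A, OF AB[symmetric]])
  also have "\<dots> = (\<Sum>m\<le>Suc n. real (Suc n choose m) *\<^sub>R (A ^^ m) ((B ^^ (Suc n - m)) x))"
    by (rule sum_choose_Suc[symmetric])
  finally show ?case .
qed

text \<open>A seminorm is the right generality: the intended \<open>l1\<close> sums over
  \<open>V\<close> only and vanishes on functions supported elsewhere.\<close>

locale seminormed =
  fixes N :: "'v::real_vector \<Rightarrow> real"
  assumes triangle: "N (x + y) \<le> N x + N y"
    and scale: "N (c *\<^sub>R x) = \<bar>c\<bar> * N x"
begin

lemma zero: "N 0 = 0"
  using scale[of 0 0] by simp

lemma sum_le: "N (\<Sum>i\<in>I. f i) \<le> (\<Sum>i\<in>I. N (f i))"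
proof (induction I rule: infinite_finite_induct)
  case (insert i I)
  then show ?case using triangle[of "f i" "\<Sum>i\<in>I. f i"] by simp
qed (simp_all add: zero)

lemma nonneg: "0 \<le> N x"
  using triangle[of x "(-1) *\<^sub>R x"] scale[of "-1" x] zero by simp

lemma funpow_le:
  assumes "\<And>x. N (R x) \<le> q * N x" "0 \<le> q"
  shows "N ((R ^^ n) x) \<le> q ^ n * N x"
proof (induction n)
  case (Suc n)
  have "N ((R ^^ Suc n) x) \<le> q * N ((R ^^ n) x)"
    using assms(1) by simp
  also have "\<dots> \<le> q * (q ^ n * N x)"
    using Suc assms(2) by (rule mult_left_mono)
  finally show ?case by (simp add: mult_ac)
qed simp

text \<open>Since \<open>S\<close> does not increase \<open>N\<close>, the norm of
  \<open>(1 - S) (1 + S)^m\<close> is at most the sum of the absolute values of its coefficients.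
  These are differences of binomial coefficients, and their sum is a mean absolute deviation for row
  \<open>Suc m\<close>.\<close>

lemma lazy_funpow_diff:
  fixes x :: 'v and m :: nat
  assumes S: "linear S" and S1: "\<And>x. N (S x) \<le> N x"
  defines "y \<equiv> ((\<lambda>x. x + S x) ^^ m) x"
  shows "N (y - S y) \<le> 2 ^ m * (2 / sqrt (real (Suc m))) * N x"
proof -
  let ?c = "\<lambda>j. real (Suc m choose j) * (real (Suc m) - 2 * real j) / real (Suc m)"
  have "y = (\<Sum>j\<le>m. real (m choose j) *\<^sub>R (S ^^ (m - j)) x)"
    unfolding y_def using binomial_linear[OF linear_id S, of m x] by simp
  also have "\<dots> = (\<Sum>j\<le>m. real (m choose j) *\<^sub>R (S ^^ j) x)"
    by (rule sum.reindex_bij_witness[of _ "\<lambda>j. m - j" "\<lambda>j. m - j"])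
      (simp_all add: binomial_symmetric[symmetric])
  finally have y: "y = (\<Sum>j\<le>m. real (m choose j) *\<^sub>R (S ^^ j) x)" .
  have "y = x + (\<Sum>j\<le>m. real (m choose Suc j) *\<^sub>R (S ^^ Suc j) x)"
  proof -
    have "y = (\<Sum>j\<le>Suc m. real (m choose j) *\<^sub>R (S ^^ j) x)"
      unfolding y by simp
    then show ?thesis
      by (subst (asm) sum.atMost_Suc_shift) simp
  qed
  moreover have "S y = (\<Sum>j\<le>m. real (m choose j) *\<^sub>R (S ^^ Suc j) x)"
    unfolding y by (simp add: linear_sum[OF S] linear_scale[OF S])
  ultimately have "y - S y =
      x + (\<Sum>j\<le>m. (real (m choose Suc j) - real (m choose j)) *\<^sub>R (S ^^ Suc j) x)"
    by (simp add: scaleR_diff_left sum_subtractf)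
  also have "\<dots> = x + (\<Sum>j\<le>m. ?c (Suc j) *\<^sub>R (S ^^ Suc j) x)"
    by (simp only: choose_Suc_minus_choose)
  \<comment> \<open>The isolated \<open>x\<close> is the term at 0, because
    \<open>?c 0 = 1\<close>.\<close>
  also have "\<dots> = (\<Sum>j\<le>Suc m. ?c j *\<^sub>R (S ^^ j) x)"
    by (subst sum.atMost_Suc_shift) simp
  finally have "N (y - S y) \<le> (\<Sum>j\<le>Suc m. N (?c j *\<^sub>R (S ^^ j) x))"
    by (simp only: sum_le)
  also have "\<dots> \<le> (\<Sum>j\<le>Suc m. \<bar>?c j\<bar> * N x)"
  proof (rule sum_mono)
    fix j
    show "N (?c j *\<^sub>R (S ^^ j) x) \<le> \<bar>?c j\<bar> * N x"
      using funpow_le[of S 1 j x] S1 unfolding scale by (intro mult_left_mono) simp_all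
  qed
  also have "\<dots> = (\<Sum>j\<le>Suc m. real (Suc m choose j) * \<bar>real (Suc m) - 2 * real j\<bar>)
      / real (Suc m) * N x"
    unfolding sum_distrib_right sum_divide_distrib
    by (rule sum.cong) (simp_all add: abs_mult del: of_nat_Suc binomial_Suc_Suc)
  also have "\<dots> \<le> 2 ^ Suc m * sqrt (real (Suc m)) / real (Suc m) * N x"
    by (intro mult_right_mono divide_right_mono binomial_mean_abs_deviation nonneg) simp_all
  also have "\<dots> = 2 ^ m * (2 / sqrt (real (Suc m))) * N x"
    using real_div_sqrt[of "real (Suc m)"]
    by (simp add: field_simps del: of_nat_Suc)
  finally show ?thesis .
qed

text \<open>The power is expanded in the commuting operators \<open>A = (p / 2) (1 + S)\<close> and
  \<open>R\<close>. The term with \<open>m\<close> factors \<open>A\<close> gains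
  \<open>2 / sqrt (Suc m)\<close>; since \<open>m\<close> is weighted like a binomial variable with
  parameters \<open>v\<close> and \<open>p\<close>, averaging the gain gives order
  \<open>1 / sqrt (p * Suc v)\<close>.\<close>

lemma lazy_mixture_funpow_diff:
  fixes x :: 'v and v :: nat
  assumes S: "linear S" and S1: "\<And>x. N (S x) \<le> N x"
    and R: "linear R" and Rq: "\<And>x. N (R x) \<le> q * N x"
    and SR: "\<And>x. S (R x) = R (S x)"
    and pq: "0 < p" "0 \<le> q" "p + q = 1"
  defines "y \<equiv> ((\<lambda>x. (p / 2) *\<^sub>R (x + S x) + R x) ^^ v) x"
  shows "N (y - S y) \<le> 2 / sqrt (p * real (Suc v)) * N x"
proof -
  define A where "A = (\<lambda>x. (p / 2) *\<^sub>R (x + S x))"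
  have A: "linear A"
    by (rule linearI) (simp_all add: A_def linear_add[OF S] linear_scale[OF S] algebra_simps)
  have AR: "A (R x) = R (A x)" for x
    by (simp add: A_def SR linear_add[OF R] linear_scale[OF R])
  have Am: "(A ^^ m) z = (p / 2) ^ m *\<^sub>R ((\<lambda>x. x + S x) ^^ m) z" for m z
    by (induction m) (simp_all add: A_def linear_scale[OF S] scaleR_add_right)
  have bound: "N ((A ^^ m) z - S ((A ^^ m) z)) \<le> p ^ m * (2 / sqrt (real (Suc m))) * N z" for m z
  proof -
    have "N ((A ^^ m) z - S ((A ^^ m) z)) =
        (p / 2) ^ m * N (((\<lambda>x. x + S x) ^^ m) z - S (((\<lambda>x. x + S x) ^^ m) z))"
      unfolding Am linear_scale[OF S] scaleR_diff_right[symmetric] scale using pq(1) by simp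
    also have "\<dots> \<le> (p / 2) ^ m * (2 ^ m * (2 / sqrt (real (Suc m))) * N z)"
      using pq(1) by (intro mult_left_mono lazy_funpow_diff S S1) simp
    finally show ?thesis by (simp add: power_divide)
  qed
  have "y = (\<Sum>m\<le>v. real (v choose m) *\<^sub>R (A ^^ m) ((R ^^ (v - m)) x))"
    unfolding y_def A_def[symmetric]
    using binomial_linear[OF A R AR, of v x] by (simp add: A_def)
  then have "y - S y = (\<Sum>m\<le>v. real (v choose m) *\<^sub>R
      ((A ^^ m) ((R ^^ (v - m)) x) - S ((A ^^ m) ((R ^^ (v - m)) x))))"
    by (simp add: linear_sum[OF S] linear_scale[OF S] scaleR_diff_right sum_subtractf)
  then have "N (y - S y) \<le> (\<Sum>m\<le>v. N (real (v choose m) *\<^sub>R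
      ((A ^^ m) ((R ^^ (v - m)) x) - S ((A ^^ m) ((R ^^ (v - m)) x)))))"
    by (simp only: sum_le)
  also have "\<dots> \<le> (\<Sum>m\<le>v. real (v choose m) *
      (p ^ m * (2 / sqrt (real (Suc m))) * (q ^ (v - m) * N x)))"
  proof (rule sum_mono)
    fix m
    have "N ((A ^^ m) ((R ^^ (v - m)) x) - S ((A ^^ m) ((R ^^ (v - m)) x)))
        \<le> p ^ m * (2 / sqrt (real (Suc m))) * N ((R ^^ (v - m)) x)"
      by (rule bound)
    also have "\<dots> \<le> p ^ m * (2 / sqrt (real (Suc m))) * (q ^ (v - m) * N x)"
      using pq by (intro mult_left_mono funpow_le Rq) simp_all
    finally show "N (real (v choose m) *\<^sub>R
        ((A ^^ m) ((R ^^ (v - m)) x) - S ((A ^^ m) ((R ^^ (v - m)) x)))) \<le>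
        real (v choose m) * (p ^ m * (2 / sqrt (real (Suc m))) * (q ^ (v - m) * N x))"
      unfolding scale abs_of_nat by (rule mult_left_mono) simp
  qed
  also have "\<dots> = 2 * (\<Sum>m\<le>v. real (v choose m) * p ^ m * q ^ (v - m) / sqrt (real (Suc m))) * N x"
    unfolding sum_distrib_right sum_distrib_left by (rule sum.cong) simp_all
  also have "\<dots> \<le> 2 * (1 / sqrt (p * real (Suc v))) * N x"
    by (intro mult_right_mono mult_left_mono binomial_mean_inverse_sqrt pq nonneg) simp
  finally show ?thesis by simp
qed

end

text \<open>The pointwise structure lets \<open>linear\<close> and the operator lemmas above apply
  to operators on functions of the vertices.\<close>

instantiation "fun" :: (type, real_vector) real_vector
begin

definition scaleR_fun_def: "c *\<^sub>R f = (\<lambda>x. c *\<^sub>R f x)"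

instance
  by standard (simp_all add: scaleR_fun_def fun_eq_iff scaleR_add_left scaleR_add_right)

end

lemma scaleR_fun_apply [simp]: "(c *\<^sub>R f) x = c *\<^sub>R f x"
  by (simp add: scaleR_fun_def)

section \<open>Cayley graphs of abelian groups\<close>

text \<open>The group enters only through the action of its generators on vertices. Commutation is
  required at every point of the type, so that shifts commute as operators on functions. Injectivity
  and the absence of fixed points make the generators correspond one to one to the neighbours of
  each vertex.\<close>

locale abelian_cayley_graph =
  fixes V :: "'a set" and \<Gamma> :: "'g set"
    and act :: "'g \<Rightarrow> 'a \<Rightarrow> 'a" and inv_gen :: "'g \<Rightarrow> 'g"
  assumes finite_V: "finite V" and finite_\<Gamma>: "finite \<Gamma>"
    and act_closed: "g \<in> \<Gamma> \<Longrightarrow> v \<in> V \<Longrightarrow> act g v \<in> V"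
    and act_commute: "g \<in> \<Gamma> \<Longrightarrow> h \<in> \<Gamma> \<Longrightarrow> act g (act h v) = act h (act g v)"
    and inv_gen_closed: "g \<in> \<Gamma> \<Longrightarrow> inv_gen g \<in> \<Gamma>"
    and inv_gen_inv_gen: "g \<in> \<Gamma> \<Longrightarrow> inv_gen (inv_gen g) = g"
    and act_inv_gen: "g \<in> \<Gamma> \<Longrightarrow> v \<in> V \<Longrightarrow> act (inv_gen g) (act g v) = v"
    and inj_on_act: "v \<in> V \<Longrightarrow> inj_on (\<lambda>g. act g v) \<Gamma>"
    and act_neq: "g \<in> \<Gamma> \<Longrightarrow> v \<in> V \<Longrightarrow> act g v \<noteq> v"
begin

definition l1 :: "('a \<Rightarrow> real) \<Rightarrow> real" where
  "l1 f = (\<Sum>v\<in>V. \<bar>f v\<bar>)"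

definition shift :: "'g \<Rightarrow> ('a \<Rightarrow> real) \<Rightarrow> 'a \<Rightarrow> real" where
  "shift g f = (\<lambda>v. f (act g v))"

definition diff :: "'g \<Rightarrow> ('a \<Rightarrow> real) \<Rightarrow> 'a \<Rightarrow> real" where
  "diff g f = f - shift g f"

text \<open>This is the operator of the diffusion matrix in terms of first differences. With no
  generators, \<open>1 / 0 = 0\<close> makes it the identity, matching the convention for the
  matrix.\<close>

definition walk :: "('a \<Rightarrow> real) \<Rightarrow> 'a \<Rightarrow> real" where
  "walk f = f - (1 / (2 * real (card \<Gamma>))) *\<^sub>R (\<Sum>g\<in>\<Gamma>. diff g f)"

sublocale l1: seminormed l1
proof
  show "l1 (f + g) \<le> l1 f + l1 g" for f g
    unfolding l1_def sum.distrib[symmetric] by (rule sum_mono) simp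
  show "l1 (c *\<^sub>R f) = \<bar>c\<bar> * l1 f" for c f
    by (simp add: l1_def sum_distrib_left abs_mult)
qed

lemma sum_fun_apply: "(\<Sum>i\<in>I. F i) x = (\<Sum>i\<in>I. F i x)" for F :: "'i \<Rightarrow> 'a \<Rightarrow> real"
  by (induction I rule: infinite_finite_induct) simp_all

section \<open>Commutation of shifts, differences and the walk\<close>

lemma bij_betw_act: "g \<in> \<Gamma> \<Longrightarrow> bij_betw (act g) V V"
  by (rule bij_betw_byWitness[where f' = "act (inv_gen g)"])
    (use act_inv_gen act_inv_gen[of "inv_gen g"] inv_gen_closed inv_gen_inv_gen act_closed in auto)

lemma bij_betw_inv_gen: "bij_betw inv_gen \<Gamma> \<Gamma>"
  by (rule bij_betw_byWitness[where f' = inv_gen])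
    (use inv_gen_closed inv_gen_inv_gen in auto)

lemma l1_shift: "g \<in> \<Gamma> \<Longrightarrow> l1 (shift g f) = l1 f"
  unfolding l1_def shift_def using sum.reindex_bij_betw[OF bij_betw_act, of g "\<lambda>v. \<bar>f v\<bar>"] by simp

lemma linear_shift: "linear (shift g)"
  by (rule linearI) (simp_all add: shift_def fun_eq_iff)

lemma linear_diff_op: "linear (diff g)"
  by (rule linearI) (simp_all add: diff_def linear_add[OF linear_shift] linear_scale[OF linear_shift]
      algebra_simps)

lemma linear_walk: "linear walk"
  by (rule linearI) (simp_all add: walk_def linear_add[OF linear_diff_op]
      linear_scale[OF linear_diff_op] sum.distrib scaleR_sum_right[symmetric] algebra_simps)

lemma shift_commute: "g \<in> \<Gamma> \<Longrightarrow> h \<in> \<Gamma> \<Longrightarrow> shift g (shift h f) = shift h (shift g f)"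
  by (simp add: shift_def fun_eq_iff act_commute)

lemma diff_shift_commute: "g \<in> \<Gamma> \<Longrightarrow> h \<in> \<Gamma> \<Longrightarrow> diff g (shift h f) = shift h (diff g f)"
  by (simp add: diff_def shift_commute linear_diff[OF linear_shift])

lemma diff_commute: "g \<in> \<Gamma> \<Longrightarrow> h \<in> \<Gamma> \<Longrightarrow> diff g (diff h f) = diff h (diff g f)"
  using diff_shift_commute[of g h f] by (simp add: diff_def[of h] linear_diff[OF linear_diff_op])

lemma diff_walk_commute: "g \<in> \<Gamma> \<Longrightarrow> diff g (walk f) = walk (diff g f)"
  by (simp add: walk_def linear_diff[OF linear_diff_op] linear_scale[OF linear_diff_op]
      linear_sum[OF linear_diff_op] diff_commute cong: sum.cong)

lemma diff_funpow_walk: "g \<in> \<Gamma> \<Longrightarrow> diff g ((walk ^^ n) f) = (walk ^^ n) (diff g f)"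
  by (rule funpow_commute) (rule diff_walk_commute)

text \<open>Half of the mass stays in place; splitting this half evenly among the generators
  exhibits the walk as the average of the lazy shifts \<open>(1 + shift h) / 2\<close>.\<close>

lemma walk_eq_average:
  assumes "\<Gamma> \<noteq> {}"
  shows "walk f = (1 / (2 * real (card \<Gamma>))) *\<^sub>R (\<Sum>h\<in>\<Gamma>. f + shift h f)"
proof -
  have c: "real (card \<Gamma>) > 0" using assms finite_\<Gamma> card_gt_0_iff by fastforce
  have "(\<Sum>h\<in>\<Gamma>. diff h f) = (2 * real (card \<Gamma>)) *\<^sub>R f - (\<Sum>h\<in>\<Gamma>. f + shift h f)"
    by (simp add: fun_eq_iff sum_fun_apply diff_def sum_subtractf sum.distrib)
  then show ?thesis
    using c by (simp add: walk_def scaleR_diff_right)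
qed

section \<open>Decay of differences under the walk\<close>

lemma l1_add_shift_le: "h \<in> \<Gamma> \<Longrightarrow> l1 (f + shift h f) \<le> 2 * l1 f"
  using l1.triangle[of f "shift h f"] by (simp add: l1_shift)

lemma l1_diff_le:
  assumes "h \<in> \<Gamma>"
  shows "l1 (diff h f) \<le> 2 * l1 f"
  using l1.triangle[of f "(-1) *\<^sub>R shift h f"] l1.scale[of "-1" "shift h f"] assms
  by (simp add: l1_shift diff_def)

text \<open>The lazy shift along \<open>g\<close> has weight \<open>1 / k\<close> in the walk, where
  \<open>k\<close> is the number of generators, and the others form an operator \<open>R\<close> of
  norm at most \<open>1 - 1 / k\<close>. This is a lazy mixture with
  \<open>p = 1 / k\<close>.\<close>

lemma l1_diff_funpow_walk:
  assumes g: "g \<in> \<Gamma>"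
  shows "l1 (diff g ((walk ^^ v) f)) \<le> 2 * sqrt (real (card \<Gamma>)) / sqrt (real (Suc v)) * l1 f"
proof -
  define k where "k = real (card \<Gamma>)"
  have k: "k \<ge> 1" using g finite_\<Gamma> card_gt_0_iff[of \<Gamma>] by (auto simp: k_def Suc_le_eq)
  define R where "R = (\<lambda>f. (1 / (2 * k)) *\<^sub>R (\<Sum>h\<in>\<Gamma> - {g}. f + shift h f))"
  have "walk f = ((1 / k) / 2) *\<^sub>R (f + shift g f) + R f" for f
  proof -
    have "\<Gamma> \<noteq> {}" using g by blast
    then have "walk f = (1 / (2 * k)) *\<^sub>R ((f + shift g f) + (\<Sum>h\<in>\<Gamma> - {g}. f + shift h f))"
      unfolding k_def sum.remove[OF finite_\<Gamma> g, of "\<lambda>h. f + shift h f", symmetric]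
      by (rule walk_eq_average)
    moreover have "(1 / k) / 2 = 1 / (2 * k)" by simp
    ultimately show ?thesis by (simp only: R_def scaleR_add_right)
  qed
  then have w: "walk = (\<lambda>f. ((1 / k) / 2) *\<^sub>R (f + shift g f) + R f)"
    by (rule ext)
  have R: "linear R"
    unfolding R_def
    by (intro linear_compose_scale_right linear_compose_sum ballI linear_compose_add
        linear_ident linear_shift)
  have Rq: "l1 (R f) \<le> (1 - 1 / k) * l1 f" for f
  proof -
    have "l1 (R f) = 1 / (2 * k) * l1 (\<Sum>h\<in>\<Gamma> - {g}. f + shift h f)"
      using k by (simp add: R_def l1.scale)
    also have "\<dots> \<le> 1 / (2 * k) * (\<Sum>h\<in>\<Gamma> - {g}. 2 * l1 f)"
      using k by (intro mult_left_mono order.trans[OF l1.sum_le] sum_mono l1_add_shift_le) simp_all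
    also have "\<dots> = 1 / (2 * k) * ((k - 1) * (2 * l1 f))"
      using g finite_\<Gamma> k by (simp add: k_def of_nat_diff)
    also have "\<dots> = (1 - 1 / k) * l1 f"
      using k by (simp add: field_simps)
    finally show ?thesis .
  qed
  have SR: "shift g (R f) = R (shift g f)" for f
  proof -
    have "shift g (R f) = (1 / (2 * k)) *\<^sub>R (\<Sum>h\<in>\<Gamma> - {g}. shift g f + shift g (shift h f))"
      by (simp only: R_def linear_scale[OF linear_shift] linear_sum[OF linear_shift]
          linear_add[OF linear_shift])
    also have "(\<Sum>h\<in>\<Gamma> - {g}. shift g f + shift g (shift h f)) =
        (\<Sum>h\<in>\<Gamma> - {g}. shift g f + shift h (shift g f))"
    proof (rule sum.cong)
      fix h assume "h \<in> \<Gamma> - {g}"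
      then have "h \<in> \<Gamma>" by simp
      from shift_commute[OF g this] show "shift g f + shift g (shift h f) = shift g f + shift h (shift g f)"
        by (rule arg_cong)
    qed simp
    finally show ?thesis by (simp only: R_def)
  qed
  have "l1 ((walk ^^ v) f - shift g ((walk ^^ v) f)) \<le> 2 / sqrt (1 / k * real (Suc v)) * l1 f"
  proof (rule l1.lazy_mixture_funpow_diff[where S = "shift g" and R = R and p = "1 / k"
        and q = "1 - 1 / k" and v = v and x = f, folded w])
    show "l1 (shift g f) \<le> l1 f" for f by (simp add: l1_shift g)
  qed (use k linear_shift R Rq SR in simp_all)
  then show ?thesis
    by (simp add: diff_def real_sqrt_divide k_def)
qed

lemma l1_walk_le: "l1 (walk f) \<le> l1 f"
proof (cases "\<Gamma> = {}")
  case True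
  then have "walk f = f" unfolding walk_def by simp
  then show ?thesis by simp
next
  case False
  then obtain g where g: "g \<in> \<Gamma>" by auto
  have k: "real (card \<Gamma>) > 0" using g finite_\<Gamma> card_gt_0_iff by fastforce
  have "l1 (walk f) = 1 / (2 * real (card \<Gamma>)) * l1 (\<Sum>h\<in>\<Gamma>. f + shift h f)"
    unfolding walk_eq_average[OF False] by (simp add: l1.scale)
  also have "\<dots> \<le> 1 / (2 * real (card \<Gamma>)) * (\<Sum>h\<in>\<Gamma>. 2 * l1 f)"
    by (intro mult_left_mono order.trans[OF l1.sum_le] sum_mono l1_add_shift_le) simp_all
  also have "\<dots> = l1 f" using k by simp
  finally show ?thesis .
qed

text \<open>Pairing each generator with its inverse turns the first differences of \<open>f - walk f\<close> into
  second differences: \<open>(1 - s) + (1 - s\<^sup>-\<^sup>1) = (1 - s) (1 - s\<^sup>-\<^sup>1)\<close>.\<close>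

lemma l1_minus_walk_le:
  "l1 (f - walk f) \<le> 1 / (4 * real (card \<Gamma>)) * (\<Sum>g\<in>\<Gamma>. l1 (diff g (diff (inv_gen g) f)))"
proof -
  \<comment> \<open>The identity is claimed on \<open>V\<close> only, where \<open>inv_gen g\<close>
    undoes \<open>g\<close>; \<open>l1\<close> sees nothing else. Each first difference is counted
    twice, which turns the factor 2 in the denominator into 4.\<close>
  have "(f - walk f) v = ((1 / (4 * real (card \<Gamma>))) *\<^sub>R (\<Sum>g\<in>\<Gamma>. diff g (diff (inv_gen g) f))) v"
    if v: "v \<in> V" for v
  proof -
    have "(\<Sum>g\<in>\<Gamma>. diff g (diff (inv_gen g) f) v) = (\<Sum>g\<in>\<Gamma>. diff g f v) + (\<Sum>g\<in>\<Gamma>. diff (inv_gen g) f v)"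
      unfolding sum.distrib[symmetric]
      by (rule sum.cong) (simp_all add: diff_def shift_def act_inv_gen v)
    also have "(\<Sum>g\<in>\<Gamma>. diff (inv_gen g) f v) = (\<Sum>g\<in>\<Gamma>. diff g f v)"
      by (rule sum.reindex_bij_betw[OF bij_betw_inv_gen])
    finally show ?thesis by (simp add: walk_def sum_fun_apply)
  qed
  then have "l1 (f - walk f) = l1 ((1 / (4 * real (card \<Gamma>))) *\<^sub>R (\<Sum>g\<in>\<Gamma>. diff g (diff (inv_gen g) f)))"
    unfolding l1_def by (intro sum.cong refl) (simp only:)
  then show ?thesis
    by (simp add: l1.scale divide_right_mono l1.sum_le)
qed

text \<open>The \<open>u\<close> steps are cut into three blocks of length \<open>u div 3\<close>,
  one for each difference. The \<open>u mod 3\<close> steps left over do not increase the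
  norm.\<close>

lemma l1_third_diff_funpow_walk:
  assumes "g \<in> \<Gamma>" "h \<in> \<Gamma>" "h' \<in> \<Gamma>"
  shows "l1 (diff h (diff h' (diff g ((walk ^^ u) f)))) \<le>
    (2 * sqrt (3 * real (card \<Gamma>)) / sqrt (real (Suc u))) ^ 3 * l1 f"
proof -
  define v where "v = u div 3"
  define K where "K = 2 * sqrt (real (card \<Gamma>)) / sqrt (real (Suc v))"
  have K0: "K \<ge> 0" by (simp add: K_def)
  have u: "u = v + (v + (v + u mod 3))" unfolding v_def by presburger
  let ?W = "walk ^^ v"
  let ?f = "(walk ^^ (u mod 3)) f"
  have eq: "diff h (diff h' (diff g ((walk ^^ u) f))) = diff h (?W (diff h' (?W (diff g (?W ?f)))))"
    unfolding diff_funpow_walk[OF assms(1)] diff_funpow_walk[OF assms(2)] diff_funpow_walk[OF assms(3)]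
    by (subst u) (simp only: funpow_add o_apply)
  have "l1 (diff h (diff h' (diff g ((walk ^^ u) f)))) \<le> K * l1 (diff h' (?W (diff g (?W ?f))))"
    unfolding eq K_def by (rule l1_diff_funpow_walk[OF assms(2)])
  also have "\<dots> \<le> K * (K * l1 (diff g (?W ?f)))"
    using l1_diff_funpow_walk[OF assms(3), of v] K0 unfolding K_def by (rule mult_left_mono)
  also have "\<dots> \<le> K * (K * (K * l1 ?f))"
    by (rule mult_left_mono[OF mult_left_mono[OF l1_diff_funpow_walk[OF assms(1), of v, folded K_def] K0] K0])
  also have "\<dots> = K ^ 3 * l1 ?f" by (simp add: power3_eq_cube)
  also have "\<dots> \<le> (2 * sqrt (3 * real (card \<Gamma>)) / sqrt (real (Suc u))) ^ 3 * l1 ?f"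
  proof (intro mult_right_mono power_mono K0 l1.nonneg)
    \<comment> \<open>Passing from the block length back to \<open>u\<close> costs the 3 under the
      square root.\<close>
    have "u + 1 \<le> 3 * (v + 1)" unfolding v_def by presburger
    then have "real (u + 1) \<le> real (3 * (v + 1))" by (simp only: of_nat_le_iff)
    then have "real (Suc u) \<le> 3 * real (Suc v)" by simp
    then have "sqrt (real (Suc u)) \<le> sqrt (3 * real (Suc v))" by simp
    then have "sqrt (real (card \<Gamma>)) * sqrt (real (Suc u)) \<le>
        sqrt (real (card \<Gamma>)) * (sqrt 3 * sqrt (real (Suc v)))"
      unfolding real_sqrt_mult by (intro mult_left_mono) simp_all
    then show "K \<le> 2 * sqrt (3 * real (card \<Gamma>)) / sqrt (real (Suc u))"
      unfolding K_def by (simp add: real_sqrt_mult field_simps del: of_nat_Suc)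
  qed
  also have "\<dots> \<le> (2 * sqrt (3 * real (card \<Gamma>)) / sqrt (real (Suc u))) ^ 3 * l1 f"
    using l1.funpow_le[of walk 1 "u mod 3" f] l1_walk_le by (intro mult_left_mono) simp_all
  finally show ?thesis .
qed

text \<open>As \<open>diff g\<close> commutes with \<open>walk\<close>, the increment is
  \<open>1 - walk\<close> applied to a first difference, hence bounded by third differences.
  Averaging gives a quarter of their common bound, and the cube of 2 over 4 is the constant
  2.\<close>

lemma l1_diff_step_le:
  assumes g: "g \<in> \<Gamma>"
  shows "l1 (diff g ((walk ^^ u) f) - diff g ((walk ^^ Suc u) f)) \<le>
    2 * sqrt (3 * real (card \<Gamma>)) ^ 3 * (1 / (real (Suc u) * sqrt (real (Suc u)))) * l1 f"
proof -
  define B where "B = (2 * sqrt (3 * real (card \<Gamma>)) / sqrt (real (Suc u))) ^ 3 * l1 f"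
  have k: "real (card \<Gamma>) > 0" using g finite_\<Gamma> card_gt_0_iff by fastforce
  have "diff g ((walk ^^ u) f) - diff g ((walk ^^ Suc u) f) =
      diff g ((walk ^^ u) f) - walk (diff g ((walk ^^ u) f))"
    by (simp add: diff_walk_commute g)
  then have "l1 (diff g ((walk ^^ u) f) - diff g ((walk ^^ Suc u) f)) \<le>
      1 / (4 * real (card \<Gamma>)) *
        (\<Sum>h\<in>\<Gamma>. l1 (diff h (diff (inv_gen h) (diff g ((walk ^^ u) f)))))"
    by (simp only: l1_minus_walk_le)
  also have "\<dots> \<le> 1 / (4 * real (card \<Gamma>)) * (\<Sum>h\<in>\<Gamma>. B)"
    unfolding B_def
    by (intro mult_left_mono sum_mono l1_third_diff_funpow_walk g inv_gen_closed) simp_all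
  also have "\<dots> = B / 4" using k by simp
  also have "\<dots> = 2 * sqrt (3 * real (card \<Gamma>)) ^ 3 * (1 / (real (Suc u) * sqrt (real (Suc u)))) * l1 f"
    unfolding B_def by (simp add: power_mult_distrib power_divide power3_eq_cube)
  finally show ?thesis .
qed

text \<open>Increments of order \<open>u^(-3/2)\<close> are summable, so the bound depends neither
  on \<open>t\<close> nor on the size of \<open>V\<close>. The 6 is 2 times the bound 3 on the
  series.\<close>

lemma l1_diff_total_variation_le:
  assumes g: "g \<in> \<Gamma>"
  shows "l1 (diff g f) + (\<Sum>u<t. l1 (diff g ((walk ^^ u) f) - diff g ((walk ^^ Suc u) f))) \<le>
    (2 + 6 * sqrt (3 * real (card \<Gamma>)) ^ 3) * l1 f"
proof -
  let ?K = "2 * sqrt (3 * real (card \<Gamma>)) ^ 3"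
  have "(\<Sum>u<t. l1 (diff g ((walk ^^ u) f) - diff g ((walk ^^ Suc u) f))) \<le>
      (\<Sum>u<t. ?K * (1 / (real (Suc u) * sqrt (real (Suc u)))) * l1 f)"
    by (intro sum_mono l1_diff_step_le g)
  also have "\<dots> = ?K * (\<Sum>u<t. 1 / (real (Suc u) * sqrt (real (Suc u)))) * l1 f"
    unfolding sum_distrib_left sum_distrib_right ..
  also have "\<dots> \<le> ?K * 3 * l1 f"
    by (intro mult_right_mono mult_left_mono sum_inverse_three_halves_le l1.nonneg) simp
  finally show ?thesis
    using l1_diff_le[OF g, of f] by (simp add: algebra_simps)
qed

end

section \<open>Diffusion on a Cayley graph\<close>

context abelian_cayley_graph
begin

definition edges :: "'a set set" where
  "edges = {{v, act g v} | v g. v \<in> V \<and> g \<in> \<Gamma>}"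

text \<open>An unordered edge may have been produced from its other endpoint; the inverse generator
  then leads from \<open>v\<close> to \<open>w\<close>.\<close>

lemma edge_iff: "v \<in> V \<Longrightarrow> {v, w} \<in> edges \<longleftrightarrow> (\<exists>g\<in>\<Gamma>. w = act g v)"
  unfolding edges_def
proof (intro iffI; clarsimp simp: doubleton_eq_iff)
  fix u g assume *: "v \<in> V" "u \<in> V" "g \<in> \<Gamma>" "v = u \<and> w = act g u \<or> v = act g u \<and> w = u"
  then show "\<exists>g\<in>\<Gamma>. w = act g v"
    using inv_gen_closed[of g] act_inv_gen[of g u] by force
qed blast

lemma neighbours_edges: "v \<in> V \<Longrightarrow> neighbours edges v = (\<lambda>g. act g v) ` \<Gamma>"
  by (auto simp: neighbours_def edge_iff)

lemma sum_neighbours: "v \<in> V \<Longrightarrow> (\<Sum>w\<in>neighbours edges v. f w) = (\<Sum>g\<in>\<Gamma>. f (act g v))"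
  by (simp add: neighbours_edges sum.reindex[OF inj_on_act])

lemma degree_edges: "v \<in> V \<Longrightarrow> degree edges v = card \<Gamma>"
  by (simp add: degree_def neighbours_edges card_image[OF inj_on_act])

lemma max_degree_edges: "V \<noteq> {} \<Longrightarrow> max_degree V edges = card \<Gamma>"
proof -
  assume "V \<noteq> {}"
  then have "degree edges ` V = {card \<Gamma>}" by (auto simp: degree_edges)
  then show ?thesis by (simp add: max_degree_def)
qed

lemma diffusion_matrix_edge:
  assumes "v \<in> V" "g \<in> \<Gamma>"
  shows "diffusion_matrix V edges v (act g v) = 1 / (2 * real (card \<Gamma>))"
    and "diffusion_matrix V edges (act g v) v = 1 / (2 * real (card \<Gamma>))"
proof -
  have "V \<noteq> {}" "act g v \<noteq> v" "v \<noteq> act g v" "{v, act g v} \<in> edges" "{act g v, v} \<in> edges"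
    using assms act_neq[of g v] edge_iff[of v "act g v"] by (auto simp: insert_commute)
  then show "diffusion_matrix V edges v (act g v) = 1 / (2 * real (card \<Gamma>))"
    "diffusion_matrix V edges (act g v) v = 1 / (2 * real (card \<Gamma>))"
    by (simp_all add: diffusion_matrix_def max_degree_edges)
qed

lemma walk_apply:
  "walk f v = f v - 1 / (2 * real (card \<Gamma>)) * (\<Sum>g\<in>\<Gamma>. f v - f (act g v))"
  by (simp add: walk_def sum_fun_apply diff_def shift_def)

text \<open>Generators enumerate the neighbours without repetition, so the off-diagonal part of the
  matrix is a sum over \<open>\<Gamma>\<close>. This identifies one step of the idealized process
  with \<open>walk\<close>.\<close>

lemma sum_diffusion_matrix:
  assumes v: "v \<in> V"
  shows "(\<Sum>i\<in>V. f i * diffusion_matrix V edges i v) = walk f v"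
proof -
  have V: "V \<noteq> {}" using v by blast
  let ?c = "1 / (2 * real (card \<Gamma>))"
  have sub: "neighbours edges v \<subseteq> V - {v}"
    using v act_closed act_neq by (auto simp: neighbours_edges)
  have "(\<Sum>i\<in>V - {v}. f i * diffusion_matrix V edges i v) =
      (\<Sum>i\<in>neighbours edges v. f i * ?c)"
    using finite_V sub
    by (intro sum.mono_neutral_cong_right)
      (auto simp: diffusion_matrix_def neighbours_def max_degree_edges[OF V] insert_commute)
  also have "\<dots> = (\<Sum>g\<in>\<Gamma>. f (act g v)) * ?c"
    by (simp add: sum_neighbours v sum_divide_distrib)
  finally have off_diagonal: "(\<Sum>i\<in>V - {v}. f i * diffusion_matrix V edges i v) =
      (\<Sum>g\<in>\<Gamma>. f (act g v)) * ?c" .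
  have diagonal: "diffusion_matrix V edges v v = 1 - real (card \<Gamma>) * ?c"
    by (simp add: diffusion_matrix_def degree_edges v max_degree_edges[OF V])
  show ?thesis
    unfolding sum.remove[OF finite_V v] off_diagonal diagonal walk_apply sum_subtractf
    by (simp only: sum_constant) (simp only: algebra_simps)
qed

section \<open>Adjoints, Duhamel's formula and antisymmetric flows\<close>

lemma sum_shift_dual:
  assumes g: "g \<in> \<Gamma>"
  shows "(\<Sum>v\<in>V. f (act g v) * h v) = (\<Sum>v\<in>V. f v * h (act (inv_gen g) v))"
proof -
  have "(\<Sum>v\<in>V. f (act g v) * h v) = (\<Sum>v\<in>V. f (act g v) * h (act (inv_gen g) (act g v)))"
    by (simp add: act_inv_gen g)
  also have "\<dots> = (\<Sum>v\<in>V. f v * h (act (inv_gen g) v))"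
    by (rule sum.reindex_bij_betw[OF bij_betw_act[OF g]])
  finally show ?thesis .
qed

text \<open>The adjoint of the shift by \<open>g\<close> is the shift by \<open>inv_gen g\<close>,
  and inversion permutes \<Gamma>.\<close>

lemma walk_self_adjoint: "(\<Sum>v\<in>V. walk f v * h v) = (\<Sum>v\<in>V. f v * walk h v)"
proof -
  have "(\<Sum>g\<in>\<Gamma>. \<Sum>v\<in>V. f (act g v) * h v) = (\<Sum>g\<in>\<Gamma>. \<Sum>v\<in>V. f v * h (act (inv_gen g) v))"
    by (simp add: sum_shift_dual cong: sum.cong)
  also have "\<dots> = (\<Sum>g\<in>\<Gamma>. \<Sum>v\<in>V. f v * h (act g v))"
    by (rule sum.reindex_bij_betw[OF bij_betw_inv_gen])
  finally have eq: "(\<Sum>v\<in>V. \<Sum>g\<in>\<Gamma>. f (act g v) * h v) = (\<Sum>v\<in>V. \<Sum>g\<in>\<Gamma>. f v * h (act g v))"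
    unfolding sum.swap[of _ V] .
  let ?c = "1 / (2 * real (card \<Gamma>))"
  have "(\<Sum>v\<in>V. walk f v * h v) = (\<Sum>v\<in>V. f v * h v) * (1 - ?c * real (card \<Gamma>)) +
      ?c * (\<Sum>v\<in>V. \<Sum>g\<in>\<Gamma>. f (act g v) * h v)"
    unfolding sum_distrib_left sum_distrib_right sum.distrib[symmetric]
    by (rule sum.cong)
      (simp_all add: walk_apply sum_subtractf algebra_simps diff_divide_distrib
        sum_distrib_left sum_divide_distrib)
  moreover have "(\<Sum>v\<in>V. f v * walk h v) = (\<Sum>v\<in>V. f v * h v) * (1 - ?c * real (card \<Gamma>)) +
      ?c * (\<Sum>v\<in>V. \<Sum>g\<in>\<Gamma>. f v * h (act g v))"
    unfolding sum_distrib_left sum_distrib_right sum.distrib[symmetric]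
    by (rule sum.cong)
      (simp_all add: walk_apply sum_subtractf algebra_simps diff_divide_distrib
        sum_distrib_left sum_divide_distrib)
  ultimately show ?thesis by (simp only: eq)
qed

text \<open>Pairing with a test function lets self-adjointness move each step of the walk onto
  \<open>\<phi>\<close>. The induction hypothesis is used for \<open>walk \<phi>\<close>, hence the
  arbitrary \<open>\<phi>\<close>.\<close>

lemma duhamel:
  assumes D0: "\<And>v. v \<in> V \<Longrightarrow> D 0 v = 0"
    and DSuc: "\<And>t v. v \<in> V \<Longrightarrow> D (Suc t) v = walk (D t) v + \<eta> (Suc t) v"
  shows "(\<Sum>v\<in>V. D t v * \<phi> v) = (\<Sum>s=1..t. \<Sum>v\<in>V. \<eta> s v * (walk ^^ (t - s)) \<phi> v)"
proof (induction t arbitrary: \<phi>)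
  case 0
  then show ?case by (simp add: D0)
next
  case (Suc t)
  have "(\<Sum>v\<in>V. D (Suc t) v * \<phi> v) =
      (\<Sum>v\<in>V. walk (D t) v * \<phi> v) + (\<Sum>v\<in>V. \<eta> (Suc t) v * \<phi> v)"
    by (simp add: DSuc distrib_right sum.distrib)
  also have "(\<Sum>v\<in>V. walk (D t) v * \<phi> v) = (\<Sum>v\<in>V. D t v * walk \<phi> v)"
    by (rule walk_self_adjoint)
  also have "\<dots> = (\<Sum>s=1..t. \<Sum>v\<in>V. \<eta> s v * (walk ^^ (t - s)) (walk \<phi>) v)"
    by (rule Suc.IH)
  also have "\<dots> = (\<Sum>s=1..t. \<Sum>v\<in>V. \<eta> s v * (walk ^^ (Suc t - s)) \<phi> v)"
    by (intro sum.cong refl) (simp add: Suc_diff_le funpow_swap1)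
  finally show ?case by simp
qed

text \<open>Discrete integration by parts: viewing each edge from its other end turns the values of
  \<open>F\<close> into differences along edges, and the two views together give the factor
  \<open>1 / 2\<close>.\<close>

lemma sum_antisymmetric_flow:
  assumes anti: "\<And>g v. g \<in> \<Gamma> \<Longrightarrow> v \<in> V \<Longrightarrow> e v (act g v) = - e (act g v) v"
  shows "(\<Sum>v\<in>V. (\<Sum>g\<in>\<Gamma>. e v (act g v)) * F v) =
    (1 / 2) * (\<Sum>g\<in>\<Gamma>. \<Sum>v\<in>V. e v (act g v) * diff g F v)"
proof -
  have "(\<Sum>g\<in>\<Gamma>. \<Sum>v\<in>V. e v (act g v) * F (act g v)) =
      (\<Sum>g\<in>\<Gamma>. \<Sum>v\<in>V. e (act (inv_gen g) v) v * F v)"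
  proof (rule sum.cong[OF refl])
    fix g assume g: "g \<in> \<Gamma>"
    have "(\<Sum>v\<in>V. e v (act g v) * F (act g v)) =
        (\<Sum>v\<in>V. e (act (inv_gen g) (act g v)) (act g v) * F (act g v))"
      by (simp add: act_inv_gen g)
    also have "\<dots> = (\<Sum>v\<in>V. e (act (inv_gen g) v) v * F v)"
      by (rule sum.reindex_bij_betw[OF bij_betw_act[OF g]])
    finally show "(\<Sum>v\<in>V. e v (act g v) * F (act g v)) = (\<Sum>v\<in>V. e (act (inv_gen g) v) v * F v)" .
  qed
  also have "\<dots> = (\<Sum>g\<in>\<Gamma>. \<Sum>v\<in>V. e (act g v) v * F v)"
    by (rule sum.reindex_bij_betw[OF bij_betw_inv_gen])
  also have "\<dots> = - (\<Sum>g\<in>\<Gamma>. \<Sum>v\<in>V. e v (act g v) * F v)"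
    by (simp add: anti sum_negf[symmetric])
  finally have "(\<Sum>g\<in>\<Gamma>. \<Sum>v\<in>V. e v (act g v) * F (act g v)) =
      - (\<Sum>g\<in>\<Gamma>. \<Sum>v\<in>V. e v (act g v) * F v)" .
  then have "(\<Sum>g\<in>\<Gamma>. \<Sum>v\<in>V. e v (act g v) * diff g F v) =
      2 * (\<Sum>g\<in>\<Gamma>. \<Sum>v\<in>V. e v (act g v) * F v)"
    by (simp add: diff_def shift_def right_diff_distrib sum_subtractf)
  then show ?thesis
    unfolding sum_distrib_right by (simp add: sum.swap[of _ V])
qed

text \<open>The deviation obeys the walk recurrence with the net rounding errors as source.
  Duhamel's formula at a point mass, integration by parts in space and summation by parts in time
  reduce it to the total variation bound; the constant is half of \<open>card \<Gamma>\<close> times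
  that bound.\<close>

lemma deviation_le:
  assumes process: "discrete_process V edges x \<Phi>"
    and errors: "accumulated_errors_at_most V edges x \<Phi> \<Lambda>"
    and \<Lambda>: "0 \<le> \<Lambda>" and l: "l \<in> V"
  shows "deviation V edges x t l \<le>
    real (card \<Gamma>) * (1 + 3 * sqrt (3 * real (card \<Gamma>)) ^ 3) * \<Lambda>"
proof -
  define c where "c = 1 / (2 * real (card \<Gamma>))"
  define e where "e = rounding_error V edges x \<Phi>"
  define \<xi> where "\<xi> = idealized_load V edges (\<lambda>i. real_of_int (x 0 i))"
  define D where "D = (\<lambda>t v. real_of_int (x t v) - \<xi> t v)"
  define \<delta> where "\<delta> = (\<lambda>v. if v = l then 1 else 0 :: real)"
  have l1_\<delta>: "l1 \<delta> = 1"
    using finite_V l by (simp add: l1_def \<delta>_def if_distrib[of abs] cong: if_cong)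
  have edge: "{v, act g v} \<in> edges" if "v \<in> V" "g \<in> \<Gamma>" for v g
    using that by (auto simp: edge_iff)
  have e: "e (Suc s) v (act g v) = c * real_of_int (x s v) - c * real_of_int (x s (act g v))
      - real_of_int (\<Phi> (Suc s) v (act g v))"
    "e (Suc s) (act g v) v = c * real_of_int (x s (act g v)) - c * real_of_int (x s v)
      - real_of_int (\<Phi> (Suc s) (act g v) v)"
    if "v \<in> V" "g \<in> \<Gamma>" for s v g
    unfolding e_def rounding_error_def c_def using that by (simp_all add: diffusion_matrix_edge)
  \<comment> \<open>Time 0 is excluded because the process constrains flows only from step 1
    on.\<close>
  have anti: "e s v (act g v) = - e s (act g v) v" if "1 \<le> s" "g \<in> \<Gamma>" "v \<in> V" for s g v
  proof -
    obtain r where r: "s = Suc r" using \<open>1 \<le> s\<close> by (cases s) auto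
    have "\<Phi> s v (act g v) = - \<Phi> s (act g v) v"
      using process edge[of v g] that unfolding discrete_process_def by blast
    then show ?thesis using that by (simp add: r e)
  qed
  \<comment> \<open>The actual flow is the ideal flow minus the error, so a discrete step is an
    exact diffusion step plus the errors on the incident edges.\<close>
  have step: "real_of_int (x (Suc t) v) =
      walk (\<lambda>v. real_of_int (x t v)) v + (\<Sum>g\<in>\<Gamma>. e (Suc t) v (act g v))" if v: "v \<in> V" for t v
  proof -
    have "x (Suc t) v = x t v - (\<Sum>g\<in>\<Gamma>. \<Phi> (Suc t) v (act g v))"
      using process v unfolding discrete_process_def
      by (metis One_nat_def diff_Suc_1 le_add1 plus_1_eq_Suc sum_neighbours)
    moreover have "(\<Sum>g\<in>\<Gamma>. e (Suc t) v (act g v)) =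
        c * (\<Sum>g\<in>\<Gamma>. real_of_int (x t v) - real_of_int (x t (act g v)))
        - (\<Sum>g\<in>\<Gamma>. real_of_int (\<Phi> (Suc t) v (act g v)))"
      by (simp add: e v sum_subtractf sum_distrib_left right_diff_distrib)
    ultimately show ?thesis by (simp add: walk_apply c_def)
  qed
  have \<xi>Suc: "\<xi> (Suc t) v = walk (\<xi> t) v" if "v \<in> V" for t v
    using sum_diffusion_matrix[OF that] by (simp add: \<xi>_def)
  have DSuc: "D (Suc t) v = walk (D t) v + (\<Sum>g\<in>\<Gamma>. e (Suc t) v (act g v))" if "v \<in> V" for t v
  proof -
    have "D t = (\<lambda>v. real_of_int (x t v)) - \<xi> t" by (simp add: D_def fun_eq_iff)
    then have "walk (D t) v = walk (\<lambda>v. real_of_int (x t v)) v - walk (\<xi> t) v"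
      by (simp add: linear_diff[OF linear_walk])
    then show ?thesis by (simp add: D_def step that \<xi>Suc)
  qed
  have "D t l = (\<Sum>v\<in>V. D t v * \<delta> v)"
    using finite_V l by (simp add: \<delta>_def if_distrib[of "\<lambda>y. _ * y"] sum.delta cong: if_cong)
  also have "\<dots> = (\<Sum>s=1..t. \<Sum>v\<in>V. (\<Sum>g\<in>\<Gamma>. e s v (act g v)) * (walk ^^ (t - s)) \<delta> v)"
    by (rule duhamel) (simp_all add: DSuc, simp add: D_def \<xi>_def)
  also have "\<dots> = (\<Sum>s=1..t. (1 / 2) *
      (\<Sum>g\<in>\<Gamma>. \<Sum>v\<in>V. e s v (act g v) * diff g ((walk ^^ (t - s)) \<delta>) v))"
    by (intro sum.cong refl sum_antisymmetric_flow anti) simp_all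
  \<comment> \<open>Time becomes the innermost sum, so that summation by parts can be applied to
    each directed edge separately.\<close>
  also have "\<dots> = (1 / 2) * (\<Sum>g\<in>\<Gamma>. \<Sum>v\<in>V. \<Sum>s=1..t. e s v (act g v) * diff g ((walk ^^ (t - s)) \<delta>) v)"
    unfolding sum_distrib_left[symmetric] sum.swap[of _ _ "{1..t}"] ..
  finally have eq: "D t l = (1 / 2) *
      (\<Sum>g\<in>\<Gamma>. \<Sum>v\<in>V. \<Sum>s=1..t. e s v (act g v) * diff g ((walk ^^ (t - s)) \<delta>) v)"
    (is "_ = _ * (\<Sum>g\<in>\<Gamma>. \<Sum>v\<in>V. ?F g v)") .
  have "\<bar>\<Sum>g\<in>\<Gamma>. \<Sum>v\<in>V. ?F g v\<bar> \<le> (\<Sum>g\<in>\<Gamma>. \<Sum>v\<in>V. \<bar>?F g v\<bar>)"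
    by (rule order.trans[OF sum_abs], rule sum_mono, rule sum_abs)
  then have "\<bar>D t l\<bar> \<le> (1 / 2) * (\<Sum>g\<in>\<Gamma>. \<Sum>v\<in>V. \<bar>?F g v\<bar>)"
    unfolding eq abs_mult by simp
  also have "\<dots> \<le> (1 / 2) * (\<Sum>g\<in>\<Gamma>. \<Sum>v\<in>V. \<Lambda> * (\<bar>diff g ((walk ^^ 0) \<delta>) v\<bar> +
      (\<Sum>u<t. \<bar>diff g ((walk ^^ u) \<delta>) v - diff g ((walk ^^ Suc u) \<delta>) v\<bar>)))"
  proof (intro mult_left_mono sum_mono)
    fix g v assume "g \<in> \<Gamma>" "v \<in> V"
    then have "\<bar>\<Sum>s=1..t. e s v (act g v)\<bar> \<le> \<Lambda>" if "1 \<le> t" for t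
      using errors edge that unfolding accumulated_errors_at_most_def e_def by blast
    then show "\<bar>\<Sum>s=1..t. e s v (act g v) * diff g ((walk ^^ (t - s)) \<delta>) v\<bar> \<le>
        \<Lambda> * (\<bar>diff g ((walk ^^ 0) \<delta>) v\<bar> +
          (\<Sum>u<t. \<bar>diff g ((walk ^^ u) \<delta>) v - diff g ((walk ^^ Suc u) \<delta>) v\<bar>))"
      by (intro abs_convolution_le[where a = "\<lambda>u. diff g ((walk ^^ u) \<delta>) v"] \<Lambda>)
  qed simp
  \<comment> \<open>Summing over the vertices turns the absolute values into \<open>l1\<close>
    norms.\<close>
  also have "\<dots> = (1 / 2) * (\<Lambda> * (\<Sum>g\<in>\<Gamma>. l1 (diff g \<delta>) +
      (\<Sum>u<t. l1 (diff g ((walk ^^ u) \<delta>) - diff g ((walk ^^ Suc u) \<delta>)))))"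
    by (simp add: l1_def sum_distrib_left[symmetric] sum.distrib sum.swap[of _ V])
  also have "\<dots> \<le> (1 / 2) * (\<Lambda> * (\<Sum>g\<in>\<Gamma>. (2 + 6 * sqrt (3 * real (card \<Gamma>)) ^ 3) * l1 \<delta>))"
    by (intro mult_left_mono sum_mono l1_diff_total_variation_le \<Lambda>) simp_all
  finally show ?thesis
    unfolding l1_\<delta> by (simp add: deviation_def D_def \<xi>_def algebra_simps)
qed

end

section \<open>The torus as a Cayley graph\<close>

text \<open>The generators are pairs of a direction and a sign; directions of length 1 contribute none and
  directions of length 2 only one, which is its own inverse.\<close>

definition torus_generators :: "nat \<Rightarrow> (nat \<Rightarrow> nat) \<Rightarrow> (nat \<times> int) set" where
  "torus_generators d n = (SIGMA k:{k\<in>{1..d}. 2 \<le> n k}. if n k = 2 then {1} else {1, -1})"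

definition torus_act :: "(nat \<Rightarrow> nat) \<Rightarrow> nat \<times> int \<Rightarrow> (nat \<Rightarrow> int) \<Rightarrow> nat \<Rightarrow> int" where
  "torus_act n g v = v(fst g := (v (fst g) + snd g) mod int (n (fst g)))"

definition torus_inv_gen :: "(nat \<Rightarrow> nat) \<Rightarrow> nat \<times> int \<Rightarrow> nat \<times> int" where
  "torus_inv_gen n g = (fst g, if n (fst g) = 2 then snd g else - snd g)"

lemma torus_vertices_coord:
  "v \<in> torus_vertices d n \<Longrightarrow> k \<in> {1..d} \<Longrightarrow> 0 \<le> v k \<and> v k < int (n k)"
  by (auto simp: torus_vertices_def PiE_def Pi_def)

lemma mod_add_eq_imp_dvd:
  fixes a :: int
  assumes "(a + s) mod m = (a + t) mod m"
  shows "m dvd s - t"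
  using assms by (simp add: mod_eq_dvd_iff)

lemma torus_act_closed:
  assumes "g \<in> torus_generators d n" "v \<in> torus_vertices d n"
  shows "torus_act n g v \<in> torus_vertices d n"
proof -
  have "fst g \<in> {1..d}" "0 < int (n (fst g))"
    using assms(1) by (auto simp: torus_generators_def)
  with assms(2) show ?thesis
    unfolding torus_act_def torus_vertices_def by (auto simp: PiE_def Pi_def extensional_def)
qed

text \<open>A side length of at least 2 cannot divide 1 or -1. The changed coordinate is named
  because injectivity of the action later recovers the direction from it.\<close>

lemma torus_act_neq:
  assumes "g \<in> torus_generators d n" "v \<in> torus_vertices d n"
  shows "torus_act n g v (fst g) \<noteq> v (fst g)"
proof
  have g: "fst g \<in> {1..d}" "2 \<le> n (fst g)" "snd g = 1 \<or> snd g = -1"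
    using assms(1) by (auto simp: torus_generators_def split: if_splits)
  assume "torus_act n g v (fst g) = v (fst g)"
  then have "(v (fst g) + snd g) mod int (n (fst g)) = (v (fst g) + 0) mod int (n (fst g))"
    using torus_vertices_coord[OF assms(2) g(1)] by (simp add: torus_act_def)
  then have "int (n (fst g)) dvd snd g"
    using mod_add_eq_imp_dvd by fastforce
  then have "int (n (fst g)) \<le> 1"
    using g(3) zdvd_imp_le[of "int (n (fst g))" 1] by auto
  with g(2) show False by simp
qed

text \<open>Additions modulo the side lengths commute. Different directions move different
  coordinates, and opposite signs in one direction act differently because they occur only for
  lengths above 2.\<close>

lemma abelian_cayley_graph_torus:
  "abelian_cayley_graph (torus_vertices d n) (torus_generators d n) (torus_act n) (torus_inv_gen n)"
proof
  show "finite (torus_vertices d n)"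
    unfolding torus_vertices_def by (intro finite_PiE) simp_all
  show "finite (torus_generators d n)"
    unfolding torus_generators_def by (intro finite_SigmaI) simp_all
next
  fix g v assume "g \<in> torus_generators d n" "v \<in> torus_vertices d n"
  then show "torus_act n g v \<in> torus_vertices d n" by (rule torus_act_closed)
next
  fix g h v
  show "torus_act n g (torus_act n h v) = torus_act n h (torus_act n g v)"
  proof (cases "fst g = fst h")
    case True
    then show ?thesis by (simp add: torus_act_def mod_simps add_ac)
  next
    case False
    then show ?thesis by (simp add: torus_act_def fun_upd_twist)
  qed
next
  fix g assume "g \<in> torus_generators d n"
  then show "torus_inv_gen n g \<in> torus_generators d n"
    by (auto simp: torus_inv_gen_def torus_generators_def split: if_splits)
next
  fix g
  show "torus_inv_gen n (torus_inv_gen n g) = g"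
    by (simp add: torus_inv_gen_def)
next
  fix g v assume g: "g \<in> torus_generators d n" and v: "v \<in> torus_vertices d n"
  have k: "fst g \<in> {1..d}" "n (fst g) = 2 \<Longrightarrow> snd g = 1"
    using g by (auto simp: torus_generators_def split: if_splits)
  \<comment> \<open>For length 2 the generator is applied twice and adds 2, which is 0 modulo the
    length.\<close>
  have "(v (fst g) + snd g + snd (torus_inv_gen n g)) mod int (n (fst g)) = v (fst g)"
    using torus_vertices_coord[OF v k(1)] k(2) by (auto simp: torus_inv_gen_def)
  then show "torus_act n (torus_inv_gen n g) (torus_act n g v) = v"
    by (simp add: torus_act_def torus_inv_gen_def mod_simps)
next
  fix v assume v: "v \<in> torus_vertices d n"
  show "inj_on (\<lambda>g. torus_act n g v) (torus_generators d n)"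
  proof (rule inj_onI)
    fix g h assume g: "g \<in> torus_generators d n" and h: "h \<in> torus_generators d n"
      and eq: "torus_act n g v = torus_act n h v"
    have fst: "fst g = fst h"
    proof (rule ccontr)
      assume "fst g \<noteq> fst h"
      then have "torus_act n h v (fst g) = v (fst g)" by (simp add: torus_act_def)
      with torus_act_neq[OF g v] eq show False by simp
    qed
    have "(v (fst g) + snd g) mod int (n (fst g)) = (v (fst g) + snd h) mod int (n (fst g))"
      using fun_cong[OF eq, of "fst g"] by (simp add: torus_act_def fst)
    then have dvd: "int (n (fst g)) dvd snd g - snd h"
      by (rule mod_add_eq_imp_dvd)
    have "snd g = snd h"
    proof (rule ccontr)
      assume "snd g \<noteq> snd h"
      then have "2 < n (fst g)" "snd g - snd h = 2 \<or> snd g - snd h = -2"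
        using g h fst by (auto simp: torus_generators_def split: if_splits)
      then have "int (n (fst g)) dvd 2"
        using dvd by (metis dvd_minus_iff)
      then have "int (n (fst g)) \<le> 2" by (rule zdvd_imp_le) simp
      with \<open>2 < n (fst g)\<close> show False by simp
    qed
    with fst show "g = h" by (simp add: prod_eq_iff)
  qed
next
  fix g v assume "g \<in> torus_generators d n" "v \<in> torus_vertices d n"
  then show "torus_act n g v \<noteq> v"
    using torus_act_neq by metis
qed

lemma card_torus_generators_le: "card (torus_generators d n) \<le> 2 * d"
proof -
  have "card (torus_generators d n) \<le> card ({1..d} \<times> {1, -1 :: int})"
    by (rule card_mono) (auto simp: torus_generators_def split: if_splits)
  then show ?thesis by (simp add: card_cartesian_product)
qed

text \<open>The condition \<open>w \<noteq> v\<close> removes precisely the directions of length 1,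
  and for length 2 both signs give the same neighbour, in accordance with the choice of
  generators.\<close>

lemma torus_edges_eq:
  assumes n: "\<And>k. k \<in> {1..d} \<Longrightarrow> 1 \<le> n k"
  shows "torus_edges d n =
    abelian_cayley_graph.edges (torus_vertices d n) (torus_generators d n) (torus_act n)"
proof -
  interpret abelian_cayley_graph "torus_vertices d n" "torus_generators d n" "torus_act n" "torus_inv_gen n"
    by (rule abelian_cayley_graph_torus)
  have iff: "w \<noteq> v \<and> (\<exists>k\<in>{1..d}. w = v(k := (v k + 1) mod int (n k)) \<or>
      w = v(k := (v k - 1) mod int (n k))) \<longleftrightarrow> (\<exists>g\<in>torus_generators d n. w = torus_act n g v)"
    (is "?L \<longleftrightarrow> ?R") if v: "v \<in> torus_vertices d n" for v w
  proof
    assume ?L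
    then obtain k s where k: "k \<in> {1..d}" and s: "s = 1 \<or> s = -1"
      and w: "w = v(k := (v k + s) mod int (n k))" and neq: "w \<noteq> v"
      by (metis uminus_add_conv_diff add.commute)
    \<comment> \<open>In a direction of length 1 the only coordinate value is 0, so the move would
      fix \<open>v\<close>.\<close>
    have "n k \<noteq> 1"
      using w neq torus_vertices_coord[OF v k] by auto
    with n[OF k] have n2: "2 \<le> n k" by simp
    show ?R
    proof (cases "n k = 2")
      case True
      have "(v k + s) mod 2 = (v k + 1) mod 2" using s by presburger
      then have "w = torus_act n (k, 1) v" using w True by (simp add: torus_act_def)
      moreover have "(k, 1) \<in> torus_generators d n" using k True by (simp add: torus_generators_def)
      ultimately show ?thesis by blast
    next
      case False
      then have "(k, s) \<in> torus_generators d n" using k n2 s by (auto simp: torus_generators_def)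
      moreover have "w = torus_act n (k, s) v" using w by (simp add: torus_act_def)
      ultimately show ?thesis by blast
    qed
  next
    assume ?R
    then obtain g where g: "g \<in> torus_generators d n" and w: "w = torus_act n g v" by blast
    then have "fst g \<in> {1..d}" "snd g = 1 \<or> snd g = -1"
      by (auto simp: torus_generators_def split: if_splits)
    then show ?L
      using act_neq[OF g v] w by (auto simp: torus_act_def)
  qed
  have "torus_edges d n =
      {{v, w} | v w. v \<in> torus_vertices d n \<and> (\<exists>g\<in>torus_generators d n. w = torus_act n g v)}"
    unfolding torus_edges_def by (intro Collect_cong ex_cong1 conj_cong refl iff)
  also have "\<dots> = edges"
    unfolding edges_def by blast
  finally show ?thesis .
qed

theorem mainTheorem2:
  fixes d :: nat
  assumes "d \<ge> 1"
  shows "\<exists>C::real. C > 0 \<and>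
    (\<forall>(n :: nat \<Rightarrow> nat) (\<Lambda> :: real)
      (x :: nat \<Rightarrow> (nat \<Rightarrow> int) \<Rightarrow> int)
      (\<Phi> :: nat \<Rightarrow> (nat \<Rightarrow> int) \<Rightarrow> (nat \<Rightarrow> int) \<Rightarrow> int).
      (\<forall>k\<in>{1..d}. n k \<ge> 1) \<longrightarrow>
      \<Lambda> \<ge> 0 \<longrightarrow>
      discrete_process (torus_vertices d n) (torus_edges d n) x \<Phi> \<longrightarrow>
      accumulated_errors_at_most (torus_vertices d n) (torus_edges d n) x \<Phi> \<Lambda> \<longrightarrow>
      (\<forall>l\<in>torus_vertices d n. \<forall>t.
         deviation (torus_vertices d n) (torus_edges d n) x t l \<le> C * \<Lambda>))"
proof (intro exI conjI allI impI ballI)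
  \<comment> \<open>The bound of \<open>deviation_le\<close> is increasing in the number of
    generators; \<open>?C\<close> is its coefficient with that number replaced by
    \<open>2 * d\<close>.\<close>
  let ?C = "2 * real d * (1 + 3 * sqrt (6 * real d) ^ 3)"
  show "?C > 0" using assms by (intro mult_pos_pos add_pos_nonneg) simp_all
  fix n :: "nat \<Rightarrow> nat" and \<Lambda> :: real and x :: "nat \<Rightarrow> (nat \<Rightarrow> int) \<Rightarrow> int"
    and \<Phi> :: "nat \<Rightarrow> (nat \<Rightarrow> int) \<Rightarrow> (nat \<Rightarrow> int) \<Rightarrow> int" and l t
  assume n: "\<forall>k\<in>{1..d}. n k \<ge> 1" and \<Lambda>: "\<Lambda> \<ge> 0"
    and process: "discrete_process (torus_vertices d n) (torus_edges d n) x \<Phi>"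
    and errors: "accumulated_errors_at_most (torus_vertices d n) (torus_edges d n) x \<Phi> \<Lambda>"
    and l: "l \<in> torus_vertices d n"
  interpret abelian_cayley_graph "torus_vertices d n" "torus_generators d n" "torus_act n" "torus_inv_gen n"
    by (rule abelian_cayley_graph_torus)
  let ?k = "real (card (torus_generators d n))"
  have edges: "torus_edges d n = edges" by (rule torus_edges_eq) (use n in simp)
  have k: "?k \<le> 2 * real d"
    using card_torus_generators_le[of d n] by linarith
  have "deviation (torus_vertices d n) (torus_edges d n) x t l \<le>
      ?k * (1 + 3 * sqrt (3 * ?k) ^ 3) * \<Lambda>"
    using process errors \<Lambda> l unfolding edges by (rule deviation_le)
  also have "\<dots> \<le> ?C * \<Lambda>"
  proof (rule mult_right_mono[OF mult_mono \<Lambda>])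
    have "sqrt (3 * ?k) ^ 3 \<le> sqrt (6 * real d) ^ 3"
      using k by (intro power_mono real_sqrt_le_mono) simp_all
    then show "1 + 3 * sqrt (3 * ?k) ^ 3 \<le> 1 + 3 * sqrt (6 * real d) ^ 3" by simp
  qed (use k in simp_all)
  finally show "deviation (torus_vertices d n) (torus_edges d n) x t l \<le> ?C * \<Lambda>" .
qed

end
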